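(* Let $p,q$ be positive integers with $\gcd(p,q)=1$, and let $s$ be a positive integer. Then $$N(SU(p),q,s)=\frac{1}{q}\binom{p-1}{s-1}\binom{q}{s}=\frac{s}{pq}\binom{p}{s}\binom{q}{s}.$$
   Context: $SU(p)$ is the group of $p\times p$ complex unitary matrices of determinant $1$. For a unitary group $G$ and positive integers $m,s$, $N(G,m,s)$ denotes the number of conjugacy classes of $G$ (under conjugation by elements of $G$) consisting of elements $x\in G$ with $x^m=1$ and such that $x$ has exactly $s$ distinct eigenvalues. *)

theory Defs
  imports
    "Jordan_Normal_Form.Schur_Decomposition"
    "Jordan_Normal_Form.Spectral_Radius"
    "HOL-Algebra.Group_Action"
begin

definition unitary_mat :: "complex mat \<Rightarrow> bool" where
  "unitary_mat A \<longleftrightarrow>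
     square_mat A \<and> inverts_mat A (mat_adjoint A) \<and> inverts_mat (mat_adjoint A) A"

definition SU :: "nat \<Rightarrow> complex mat monoid" where
  "SU n = \<lparr>carrier = {A \<in> carrier_mat n n. unitary_mat A \<and> det A = 1},
           mult = (*), one = 1\<^sub>m n\<rparr>"

(* The conjugation action is written exactly as in group.action_by_conjugation. *)
definition conjugacy_classes :: "('a, 'b) monoid_scheme \<Rightarrow> 'a set set" where
  "conjugacy_classes G =
     orbits G (carrier G) (\<lambda>g. \<lambda>h\<in>carrier G. g \<otimes>\<^bsub>G\<^esub> h \<otimes>\<^bsub>G\<^esub> inv\<^bsub>G\<^esub> g)"

(* The spectrum is the set of eigenvalues, so its cardinality ignores multiplicities. *)
definition num_conj_classes :: "complex mat monoid \<Rightarrow> nat \<Rightarrow> nat \<Rightarrow> nat" where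
  "num_conj_classes G m s = card {C \<in> conjugacy_classes G.
     \<forall>x\<in>C. x [^]\<^bsub>G\<^esub> m = \<one>\<^bsub>G\<^esub> \<and> card (spectrum x) = s}"

lemma carrier_SU: "A \<in> carrier (SU n) \<longleftrightarrow> A \<in> carrier_mat n n \<and> unitary_mat A \<and> det A = 1"
  by (simp add: SU_def)

lemma mult_SU: "A \<otimes>\<^bsub>SU n\<^esub> B = A * B"
  by (simp add: SU_def)

lemma one_SU: "\<one>\<^bsub>SU n\<^esub> = 1\<^sub>m n"
  by (simp add: SU_def)

lemma mat_adjoint_carrier: "A \<in> carrier_mat n n \<Longrightarrow> mat_adjoint A \<in> carrier_mat n n"
  for A :: "complex mat"
  unfolding mat_adjoint_def mat_of_rows_def by auto

lemma mat_adjoint_index: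
  "A \<in> carrier_mat n n \<Longrightarrow> i < n \<Longrightarrow> j < n \<Longrightarrow> mat_adjoint A $$ (i, j) = cnj (A $$ (j, i))"
  by (auto simp: mat_adjoint_def mat_of_rows_def)

lemma mat_adjoint_mult:
  assumes A: "A \<in> carrier_mat n n" and B: "B \<in> carrier_mat n n"
  shows "mat_adjoint (A * B) = mat_adjoint B * mat_adjoint (A :: complex mat)"
proof (rule eq_matI)
  note A' = mat_adjoint_carrier[OF A] and B' = mat_adjoint_carrier[OF B]
  fix i j assume "i < dim_row (mat_adjoint B * mat_adjoint A)"
    and "j < dim_col (mat_adjoint B * mat_adjoint A)"
  then have ij: "i < n" "j < n" using A' B' by auto
  have "mat_adjoint (A * B) $$ (i, j) = cnj (\<Sum>k = 0..<n. A $$ (j, k) * B $$ (k, i))"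
    using A B ij by (subst mat_adjoint_index[of _ n]) (auto simp: scalar_prod_def)
  also have "\<dots> = (\<Sum>k = 0..<n. mat_adjoint B $$ (i, k) * mat_adjoint A $$ (k, j))"
    using A B ij by (simp add: cnj_sum mat_adjoint_index mult.commute)
  also have "\<dots> = (mat_adjoint B * mat_adjoint A) $$ (i, j)"
    using A' B' ij by (auto simp: scalar_prod_def)
  finally show "mat_adjoint (A * B) $$ (i, j) = (mat_adjoint B * mat_adjoint A) $$ (i, j)" .
qed (use mat_adjoint_carrier[OF A] mat_adjoint_carrier[OF B]
      mat_adjoint_carrier[OF mult_carrier_mat[OF A B]] in auto)

lemma mat_adjoint_adjoint:
  assumes A: "A \<in> carrier_mat n n"
  shows "mat_adjoint (mat_adjoint A) = (A :: complex mat)"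
  using A mat_adjoint_carrier[OF A] mat_adjoint_carrier[OF mat_adjoint_carrier[OF A]]
  by (intro eq_matI) (auto simp: mat_adjoint_index)

lemma mat_adjoint_one: "mat_adjoint (1\<^sub>m n) = (1\<^sub>m n :: complex mat)"
  using mat_adjoint_carrier[of "1\<^sub>m n" n]
  by (intro eq_matI) (auto simp: mat_adjoint_index[of _ n])

lemma unitary_matD:
  assumes "A \<in> carrier_mat n n" "unitary_mat A"
  shows "A * mat_adjoint A = 1\<^sub>m n" "mat_adjoint A * A = 1\<^sub>m n"
  using assms mat_adjoint_carrier[OF assms(1)] by (auto simp: unitary_mat_def inverts_mat_def)

lemma unitary_matI:
  assumes A: "A \<in> carrier_mat n n" and "A * mat_adjoint A = 1\<^sub>m n"
  shows "unitary_mat A"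
  using assms mat_adjoint_carrier[OF A]
    mat_mult_left_right_inverse[OF A mat_adjoint_carrier[OF A]]
  by (auto simp: unitary_mat_def inverts_mat_def)

lemma unitary_mat_mult:
  assumes A: "A \<in> carrier_mat n n" "unitary_mat A" and B: "B \<in> carrier_mat n n" "unitary_mat B"
  shows "unitary_mat (A * B)"
proof (rule unitary_matI[of _ n])
  note c = A(1) B(1) mat_adjoint_carrier[OF A(1)] mat_adjoint_carrier[OF B(1)]
  have "A * B * mat_adjoint (A * B) = A * (B * mat_adjoint B) * mat_adjoint A"
    using c by (simp add: mat_adjoint_mult assoc_mult_mat[of _ n n _ n _ n])
  then show "A * B * mat_adjoint (A * B) = 1\<^sub>m n"
    using c by (simp add: unitary_matD[OF A] unitary_matD[OF B])
qed (use A B in auto)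

lemma adjoint_in_SU:
  assumes "A \<in> carrier (SU n)"
  shows "mat_adjoint A \<in> carrier (SU n)" "mat_adjoint A * A = 1\<^sub>m n"
proof -
  have A: "A \<in> carrier_mat n n" "unitary_mat A" and d: "det A = 1"
    using assms by (auto simp: carrier_SU)
  note A' = mat_adjoint_carrier[OF A(1)]
  show "mat_adjoint A * A = 1\<^sub>m n" by (rule unitary_matD[OF A])
  have "det (mat_adjoint A) * det A = det (mat_adjoint A * A)"
    by (rule det_mult[symmetric, OF A' A(1)])
  then have "det (mat_adjoint A) = 1" by (simp add: unitary_matD[OF A] d)
  moreover have "unitary_mat (mat_adjoint A)"
    by (rule unitary_matI[OF A']) (simp add: mat_adjoint_adjoint[OF A(1)] unitary_matD[OF A])
  ultimately show "mat_adjoint A \<in> carrier (SU n)" using A' by (simp add: carrier_SU)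
qed

lemma group_SU: "group (SU n)"
proof (rule groupI)
  fix A B assume "A \<in> carrier (SU n)" "B \<in> carrier (SU n)"
  then show "A \<otimes>\<^bsub>SU n\<^esub> B \<in> carrier (SU n)"
    by (auto simp: carrier_SU mult_SU det_mult unitary_mat_mult)
next
  show "\<one>\<^bsub>SU n\<^esub> \<in> carrier (SU n)"
    by (auto simp: carrier_SU one_SU mat_adjoint_one intro!: unitary_matI[of _ n])
next
  fix A assume "A \<in> carrier (SU n)"
  then show "\<exists>B\<in>carrier (SU n). B \<otimes>\<^bsub>SU n\<^esub> A = \<one>\<^bsub>SU n\<^esub>"
    by (intro bexI[of _ "mat_adjoint A"]) (simp_all add: mult_SU one_SU adjoint_in_SU)
qed (auto simp: carrier_SU mult_SU one_SU)

end

theory Submission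
  imports Defs
begin

text \<open>
  A unitary matrix is unitarily diagonalizable, with the eigenvalues in any prescribed order, and the
  diagonalizing matrix can be rescaled to have determinant 1. Hence conjugacy classes in \<open>SU(p)\<close> are
  determined by the characteristic polynomial, and the classes to be counted correspond to the
  multisets of \<open>p\<close> many \<open>q\<close>-th roots of unity with \<open>s\<close> distinct elements and product 1.
  Without the condition on the product there are \<open>(p - 1 choose s - 1) * (q choose s)\<close> such multisets.
  Multiplying all elements by a root of unity \<open>w\<close> multiplies the product by \<open>w ^ p\<close>; as \<open>p\<close> is coprime
  to \<open>q\<close>, all \<open>q\<close> possible products are attained equally often.
\<close>

section \<open>Multisets of roots of unity\<close>

text \<open>Stars and bars: taking away one copy of each element of \<open>A\<close> leaves an
  arbitrary multiset of size \<open>n - card A\<close> over \<open>A\<close>, and adding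
  \<open>mset_set A\<close> undoes this.\<close>

lemma card_multisets_full_support:
  assumes "finite A" "A \<noteq> {}" "n > 0"
  shows "card {M. set_mset M = A \<and> size M = n} = (n - 1) choose (card A - 1)"
proof (cases "card A \<le> n")
  case True
  have pos: "card A > 0"
    using assms by (simp add: card_gt_0_iff)
  have "bij_betw (\<lambda>M. M + mset_set A) (multisets_of_size A (n - card A))
          {M. set_mset M = A \<and> size M = n}"
  proof (rule bij_betwI[where g = "\<lambda>M. M - mset_set A"])
    show "(\<lambda>M. M - mset_set A) \<in> {M. set_mset M = A \<and> size M = n} \<rightarrow> multisets_of_size A (n - card A)"
    proof
      fix M assume M: "M \<in> {M. set_mset M = A \<and> size M = n}"
      hence "mset_set A \<subseteq># M"
        by (auto simp: mset_set_set_mset_msubset)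
      thus "M - mset_set A \<in> multisets_of_size A (n - card A)"
        using M by (auto simp: multisets_of_size_def size_Diff_submset dest: in_diffD)
    qed
  next
    fix M assume "M \<in> {M. set_mset M = A \<and> size M = n}"
    thus "M - mset_set A + mset_set A = M"
      by (auto simp: mset_set_set_mset_msubset)
  qed (use assms True in \<open>auto simp: multisets_of_size_def\<close>)
  hence "card {M. set_mset M = A \<and> size M = n} = (n - 1) choose (n - card A)"
    using assms True by (simp add: card_multisets_of_size flip: bij_betw_same_card)
  also have "\<dots> = (n - 1) choose (card A - 1)"
    using pos True binomial_symmetric[of "card A - 1" "n - 1"] by simp
  finally show ?thesis .
next
  case False
  \<comment> \<open>A multiset with support \<open>A\<close> contains \<open>mset_set A\<close>, so
    it cannot be smaller than \<open>A\<close>. On the other side \<open>n > 0\<close> guarantees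
    that \<open>card A - 1\<close> exceeds \<open>n - 1\<close> in spite of truncated subtraction,
    so the binomial vanishes too.\<close>
  have empty: "{M. set_mset M = A \<and> size M = n} = {}"
    using False size_mset_mono[OF mset_set_set_mset_msubset] by fastforce
  show ?thesis
    unfolding empty using False assms(3) by (simp add: binomial_eq_0)
qed

text \<open>Sort the multisets by their support: every \<open>s\<close>-element subset of
  \<open>A\<close> contributes the same number.\<close>

lemma card_multisets_support_card:
  assumes "finite A" "n > 0" "s > 0"
  shows "card {M. set_mset M \<subseteq> A \<and> size M = n \<and> card (set_mset M) = s}
           = ((n - 1) choose (s - 1)) * (card A choose s)"
proof -
  let ?K = "{B. B \<subseteq> A \<and> card B = s}"
  have fin: "finite ?K"
    using assms(1) by simp
  have "{M. set_mset M \<subseteq> A \<and> size M = n \<and> card (set_mset M) = s}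
      = (\<Union>B\<in>?K. {M. set_mset M = B \<and> size M = n})"
    by auto
  also have "card \<dots> = (\<Sum>B\<in>?K. card {M. set_mset M = B \<and> size M = n})"
  proof (rule card_UN_disjoint[OF fin])
    show "\<forall>B\<in>?K. finite {M. set_mset M = B \<and> size M = n}"
    proof
      fix B assume "B \<in> ?K"
      hence "finite B" using assms(1) by (auto intro: finite_subset)
      thus "finite {M. set_mset M = B \<and> size M = n}"
        by (rule finite_subset[rotated, OF finite_multisets_of_size[of B n]])
           (auto simp: multisets_of_size_def)
    qed
  qed auto
  also have "\<dots> = (\<Sum>B\<in>?K. (n - 1) choose (s - 1))"
  proof (rule sum.cong[OF refl])
    fix B assume B: "B \<in> ?K"
    hence "finite B" "B \<noteq> {}" using assms by (auto intro: finite_subset)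
    thus "card {M. set_mset M = B \<and> size M = n} = (n - 1) choose (s - 1)"
      using B card_multisets_full_support[of B n] assms(2) by simp
  qed
  also have "\<dots> = ((n - 1) choose (s - 1)) * (card A choose s)"
    by (simp add: n_subsets[OF assms(1)])
  finally show ?thesis .
qed

lemma prod_mset_image_mult: "prod_mset (image_mset ((*) w) M) = w ^ size M * prod_mset M"
  for w :: "'a :: comm_monoid_mult"
  by (induction M) (simp_all add: ac_simps)

lemma prod_mset_roots_of_unity:
  fixes M :: "'a :: comm_monoid_mult multiset"
  assumes "\<forall>z\<in>#M. z ^ q = 1"
  shows "prod_mset M ^ q = 1"
  using assms by (induction M) (simp_all add: power_mult_distrib)

text \<open>An inverse of \<open>p\<close> modulo \<open>q\<close> provides the exponent: if
  \<open>x\<close> is one, then \<open>w = r ^ x\<close> works. This makes the shift argument below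
  reach every possible product.\<close>

lemma power_coprime_surj_roots_of_unity:
  fixes r :: "'a :: comm_monoid_mult"
  assumes "coprime p q" "q > 0" "r ^ q = 1"
  obtains w where "w ^ q = 1" "w ^ p = r"
proof (cases "p = 0")
  case True
  hence "q = 1" using assms(1) by simp
  thus ?thesis using that[of 1] assms(3) True by simp
next
  case False
  \<comment> \<open>Bezout over the naturals. The case \<open>p = 0\<close> had to be split off,
    since then the left-hand side is 0 and no such \<open>x\<close>, \<open>y\<close> exist.\<close>
  obtain x y where xy: "p * x = q * y + 1"
    using coprime_bezout_strong[of p q] bezout_nat[of p q] False assms(1) by (metis coprime_iff_gcd_eq_1)
  have "(r ^ x) ^ q = 1"
    by (metis assms(3) power_mult mult.commute power_one)
  moreover have "(r ^ x) ^ p = r"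
  proof -
    have "(r ^ x) ^ p = r ^ (p * x)" by (metis power_mult mult.commute)
    also have "\<dots> = (r ^ q) ^ y * r" by (simp add: xy power_add power_mult ac_simps)
    finally show ?thesis using assms(3) by simp
  qed
  ultimately show ?thesis by (rule that)
qed

lemma card_multisets_roots_of_unity_prod_1:
  assumes "coprime p q" "p > 0" "q > 0" "s > 0"
  shows "q * card {M :: complex multiset. (\<forall>z\<in>#M. z ^ q = 1) \<and> size M = p \<and>
                     card (set_mset M) = s \<and> prod_mset M = 1}
         = ((p - 1) choose (s - 1)) * (q choose s)"
proof -
  define R where "R = {z :: complex. z ^ q = 1}"
  define T where "T = {M. set_mset M \<subseteq> R \<and> size M = p \<and> card (set_mset M) = s}"
  define P where "P r = {M \<in> T. prod_mset M = r}" for r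
  have finR: "finite R" and cardR: "card R = q"
    unfolding R_def using assms(3) by (auto simp: card_roots_unity_eq finite_roots_unity)
  have finT: "finite T"
    by (rule finite_subset[OF _ finite_multisets_of_size[OF finR, of p]])
       (auto simp: T_def multisets_of_size_def)
  have T: "T = (\<Union>r\<in>R. P r)"
    by (auto simp: P_def T_def R_def subset_iff intro: prod_mset_roots_of_unity)
  \<comment> \<open>Multiplication by a root of unity is injective, so the number of distinct
    elements survives, while the product picks up \<open>w\<close> once for each of the
    \<open>p\<close> elements.\<close>
  have shift: "image_mset ((*) w) M \<in> P (w ^ p * r)" if "w \<in> R" "M \<in> P r" for w r M
  proof -
    have "w \<noteq> 0" using that(1) assms(3) by (auto simp: R_def power_0_left)
    hence "card ((*) w ` set_mset M) = card (set_mset M)"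
      by (intro card_image) (auto simp: inj_on_def)
    thus ?thesis
      using that by (auto simp: P_def T_def R_def prod_mset_image_mult power_mult_distrib)
  qed
  have "card (P r) = card (P 1)" if r: "r \<in> R" for r
  proof -
    obtain w where w: "w ^ q = 1" "w ^ p = r"
      using power_coprime_surj_roots_of_unity[OF assms(1,3), of r] r by (auto simp: R_def)
    have w0: "w \<noteq> 0" "r \<noteq> 0" using w r assms(3) by (auto simp: R_def power_0_left)
    have "bij_betw (image_mset ((*) w)) (P 1) (P r)"
    proof (rule bij_betwI[where g = "image_mset ((*) (inverse w))"])
      show "image_mset ((*) w) \<in> P 1 \<rightarrow> P r"
        using shift[of w _ 1] w by (auto simp: R_def)
      show "image_mset ((*) (inverse w)) \<in> P r \<rightarrow> P 1"
        using shift[of "inverse w" _ r] w w0 by (auto simp: R_def power_inverse)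
    qed (simp_all add: multiset.map_comp comp_def w0 flip: mult.assoc)
    thus ?thesis by (simp flip: bij_betw_same_card)
  qed
  \<comment> \<open>The fibres \<open>P r\<close> of the product map are disjoint, there are
    \<open>q\<close> of them, and all have the size of \<open>P 1\<close>.\<close>
  hence "card T = q * card (P 1)"
    unfolding T using finR finT by (subst card_UN_disjoint) (auto simp: P_def cardR)
  moreover have "card T = ((p - 1) choose (s - 1)) * (q choose s)"
    unfolding T_def using card_multisets_support_card[OF finR assms(2,4)] cardR by simp
  moreover have "P 1 = {M :: complex multiset. (\<forall>z\<in>#M. z ^ q = 1) \<and> size M = p \<and>
                     card (set_mset M) = s \<and> prod_mset M = 1}"
    by (auto simp: P_def T_def R_def)
  ultimately show ?thesis by simp
qed

section \<open>Unitary diagonalization\<close>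

definition direct_sum_scalar :: "'a \<Rightarrow> 'a :: zero mat \<Rightarrow> 'a mat" where
  "direct_sum_scalar a B =
     four_block_mat (mat 1 1 (\<lambda>_. a)) (0\<^sub>m 1 (dim_col B)) (0\<^sub>m (dim_row B) 1) B"

lemma direct_sum_scalar_carrier [simp]:
  "B \<in> carrier_mat n n \<Longrightarrow> direct_sum_scalar a B \<in> carrier_mat (Suc n) (Suc n)"
  by (auto simp: direct_sum_scalar_def)

lemma dim_direct_sum_scalar [simp]:
  "dim_row (direct_sum_scalar a B) = Suc (dim_row B)"
  "dim_col (direct_sum_scalar a B) = Suc (dim_col B)"
  by (simp_all add: direct_sum_scalar_def)

lemma index_direct_sum_scalar [simp]:
  assumes "i < Suc (dim_row B)" "j < Suc (dim_col B)"
  shows "direct_sum_scalar a B $$ (i, j) =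
           (if i = 0 \<and> j = 0 then a else if i = 0 \<or> j = 0 then 0 else B $$ (i - 1, j - 1))"
  using assms by (auto simp: direct_sum_scalar_def)

lemma direct_sum_scalar_mult:
  fixes A B :: "'a :: comm_ring_1 mat"
  assumes "A \<in> carrier_mat n n" "B \<in> carrier_mat n n"
  shows "direct_sum_scalar a A * direct_sum_scalar b B = direct_sum_scalar (a * b) (A * B)"
proof -
  have "mat 1 1 (\<lambda>_. a) * mat 1 1 (\<lambda>_. b) = mat 1 1 (\<lambda>_. a * b)"
    by (intro eq_matI) (auto simp: scalar_prod_def)
  thus ?thesis
    using assms unfolding direct_sum_scalar_def
    by (subst mult_four_block_mat[of _ 1 1 _ n _ n _ _ 1 _ n]) auto
qed

lemma mat_adjoint_direct_sum_scalar:
  fixes B :: "complex mat"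
  assumes "B \<in> carrier_mat n n"
  shows "mat_adjoint (direct_sum_scalar a B) = direct_sum_scalar (cnj a) (mat_adjoint B)"
  using assms mat_adjoint_carrier[OF assms]
    mat_adjoint_carrier[OF direct_sum_scalar_carrier[OF assms, of a]]
    direct_sum_scalar_carrier[OF mat_adjoint_carrier[OF assms], of "cnj a"]
  by (intro eq_matI) (auto simp: mat_adjoint_index[of _ n] mat_adjoint_index[of _ "Suc n"])

lemma direct_sum_scalar_one: "direct_sum_scalar 1 (1\<^sub>m n) = 1\<^sub>m (Suc n)"
  by (intro eq_matI) auto

lemma direct_sum_scalar_eqD:
  assumes "direct_sum_scalar a A = direct_sum_scalar b B" "A \<in> carrier_mat n n" "B \<in> carrier_mat n n"
  shows "A = B"
proof (rule eq_matI)
  fix i j assume "i < dim_row B" "j < dim_col B"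
  thus "A $$ (i, j) = B $$ (i, j)"
    using assms(2,3) arg_cong[OF assms(1), of "\<lambda>M. M $$ (Suc i, Suc j)"] by simp
qed (use assms in auto)

lemma direct_sum_scalar_mat_diag:
  "direct_sum_scalar a (mat_diag n ((!) as)) = mat_diag (Suc n) ((!) (a # as))"
  by (intro eq_matI) (auto simp: mat_diag_def nth_Cons')

lemma char_poly_direct_sum_scalar:
  fixes B :: "'a :: idom mat"
  assumes "B \<in> carrier_mat n n"
  shows "char_poly (direct_sum_scalar a B) = [:- a, 1:] * char_poly B"
proof -
  have "char_poly (mat 1 1 (\<lambda>_. a)) = [:- a, 1:]"
    by (simp add: char_poly_defs det_def sign_def)
  thus ?thesis
    using assms char_poly_four_block_zeros_col[of "mat 1 1 (\<lambda>_. a)" "0\<^sub>m 1 n" n B]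
    by (simp add: direct_sum_scalar_def)
qed

section \<open>Deflation of a unitary matrix at an eigenvector\<close>

lemma unitary_mat_adjoint:
  assumes "A \<in> carrier_mat n n" "unitary_mat A"
  shows "unitary_mat (mat_adjoint A)"
  using assms by (auto intro!: unitary_matI[of _ n] mat_adjoint_carrier
      simp: mat_adjoint_adjoint unitary_matD)

text \<open>Complete \<open>v\<close> to a basis, orthogonalize, and normalize the columns.
  Gram-Schmidt leaves the first vector alone, so the first column stays a multiple of
  \<open>v\<close>.\<close>

lemma unitary_mat_with_eigenvector_col:
  fixes v :: "complex vec"
  assumes v: "v \<in> carrier_vec n" "v \<noteq> 0\<^sub>v n"
  obtains W c where "W \<in> carrier_mat n n" "unitary_mat W" "col W 0 = c \<cdot>\<^sub>v v"
proof -
  interpret cof_vec_space n "TYPE(complex)" .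
  define b where "b = basis_completion v"
  define ws where "ws = gram_schmidt n b"
  note bc = basis_completion[OF v, folded b_def]
  have n: "n > 0"
    using v by (cases n) auto
  obtain vs where bv: "b = v # vs"
    using bc(6,7) n by (cases b) auto
  have ws: "set ws \<subseteq> carrier_vec n" "corthogonal ws" "length ws = n"
    using gram_schmidt_result[OF bc(2,4,5) ws_def] bc(6) by auto
  have hd: "ws ! 0 = v"
    using gram_schmidt_hd[OF v(1), of vs] ws n unfolding ws_def bv
    by (metis hd_conv_nth length_0_conv less_numeral_extra(3))
  \<comment> \<open>\<open>gram_schmidt\<close> yields orthogonal vectors that need not have length
    1. \<open>d i\<close> is the length of the \<open>i\<close>-th one, kept as a complex number so
    that it can scale a column.\<close>
  define d where "d i = complex_of_real (sqrt (Re (ws ! i \<bullet>c ws ! i)))" for i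
  define V where "V = mat_of_cols n ws"
  define W where "W = V * mat_diag n (\<lambda>i. inverse (d i))"
  have wsn: "ws ! i \<in> carrier_vec n" if "i < n" for i
    using ws that nth_mem by blast
  have V: "V \<in> carrier_mat n n"
    using ws by (auto simp: V_def)
  hence W: "W \<in> carrier_mat n n"
    by (auto simp: W_def)
  have Wij: "W $$ (i, j) = ws ! j $ i * inverse (d j)" if "i < n" "j < n" for i j
    using that ws V by (simp add: W_def mat_diag_mult_right[OF V]) (simp add: V_def mat_of_cols_index)
  have dd: "d i * d i = ws ! i \<bullet>c ws ! i" "d i \<noteq> 0" "cnj (d i) = d i" if "i < n" for i
  proof -
    have "ws ! i \<bullet>c ws ! i \<noteq> 0"
      using corthogonalD[OF ws(2), of i i] that ws(3) by simp
    moreover have "ws ! i \<bullet>c ws ! i \<ge> 0"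
      by (rule conjugate_square_ge_0_vec)
    ultimately have *: "Re (ws ! i \<bullet>c ws ! i) > 0" "Im (ws ! i \<bullet>c ws ! i) = 0"
      by (auto simp: less_eq_complex_def complex_eq_iff)
    thus "d i * d i = ws ! i \<bullet>c ws ! i"
      by (simp add: d_def complex_eq_iff)
    show "d i \<noteq> 0" "cnj (d i) = d i"
      using * by (auto simp: d_def)
  qed
  have "mat_adjoint W * W = 1\<^sub>m n"
  proof (rule eq_matI)
    fix i j assume "i < dim_row (1\<^sub>m n :: complex mat)" "j < dim_col (1\<^sub>m n :: complex mat)"
    hence ij: "i < n" "j < n" by auto
    have "(mat_adjoint W * W) $$ (i, j) = (\<Sum>k<n. cnj (W $$ (k, i)) * W $$ (k, j))"
      using ij W mat_adjoint_carrier[OF W]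
      by (auto simp: scalar_prod_def mat_adjoint_index[OF W] atLeast0LessThan intro!: sum.cong)
    also have "\<dots> = (\<Sum>k<n. ws ! j $ k * cnj (ws ! i $ k)) * (inverse (d i) * inverse (d j))"
      unfolding sum_distrib_right by (intro sum.cong) (auto simp: Wij ij dd)
    also have "(\<Sum>k<n. ws ! j $ k * cnj (ws ! i $ k)) = ws ! j \<bullet>c ws ! i"
      using wsn[OF ij(1)] wsn[OF ij(2)] by (auto simp: scalar_prod_def atLeast0LessThan)
    also have "\<dots> * (inverse (d i) * inverse (d j)) = (if i = j then 1 else 0)"
      using ij dd[of i] corthogonalD[OF ws(2), of j i] ws(3)
      by (auto simp: field_simps simp flip: dd(1))
    finally show "(mat_adjoint W * W) $$ (i, j) = 1\<^sub>m n $$ (i, j)"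
      using ij by simp
  qed (use W mat_adjoint_carrier[OF W] in auto)
  \<comment> \<open>\<open>unitary_matI\<close> expects the adjoint as the right factor, so it is
    applied to the adjoint of \<open>W\<close>; taking adjoints again returns to
    \<open>W\<close>.\<close>
  hence "unitary_mat (mat_adjoint W)"
    using unitary_matI[OF mat_adjoint_carrier[OF W]] W by (simp add: mat_adjoint_adjoint)
  hence "unitary_mat W"
    using unitary_mat_adjoint[OF mat_adjoint_carrier[OF W]] W by (simp add: mat_adjoint_adjoint)
  moreover have "col W 0 = inverse (d 0) \<cdot>\<^sub>v v"
    using W n v hd by (intro eq_vecI) (auto simp: Wij)
  ultimately show ?thesis using that W by blast
qed

text \<open>The columns of \<open>A\<close> are orthonormal and column 0 has only its top entry
  \<open>e\<close>. Its length forces \<open>e\<close> to be nonzero, and orthogonality to the other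
  columns then kills the rest of row 0.\<close>

lemma unitary_mat_first_col_scalar:
  fixes A :: "complex mat"
  assumes A: "A \<in> carrier_mat (Suc n) (Suc n)" "unitary_mat A"
    and col: "\<And>i. 0 < i \<Longrightarrow> i < Suc n \<Longrightarrow> A $$ (i, 0) = 0"
  obtains B where "B \<in> carrier_mat n n" "unitary_mat B" "A = direct_sum_scalar (A $$ (0, 0)) B"
proof -
  let ?e = "A $$ (0, 0)"
  note A' = mat_adjoint_carrier[OF A(1)]
  have prod: "cnj (A $$ (0, i)) * ?e = (if i = 0 then 1 else 0)" if "i < Suc n" for i
  proof -
    have "(mat_adjoint A * A) $$ (i, 0) = (\<Sum>k<Suc n. cnj (A $$ (k, i)) * A $$ (k, 0))"
      using that A A'
      by (auto simp: scalar_prod_def mat_adjoint_index[OF A(1)] atLeast0LessThan simp del: sum.lessThan_Suc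
           intro!: sum.cong)
    also have "\<dots> = cnj (A $$ (0, i)) * ?e"
      by (subst sum.remove[of _ 0]) (auto simp: col intro!: sum.neutral)
    finally show ?thesis using that by (simp add: unitary_matD[OF A])
  qed
  hence "?e \<noteq> 0"
    by force
  hence row: "A $$ (0, i) = 0" if "0 < i" "i < Suc n" for i
    using prod[of i] that by simp
  define B where "B = mat n n (\<lambda>(i, j). A $$ (Suc i, Suc j))"
  have B: "B \<in> carrier_mat n n" by (simp add: B_def)
  note B' = mat_adjoint_carrier[OF B]
  have AB: "A = direct_sum_scalar ?e B"
    using A(1) direct_sum_scalar_carrier[OF B, of ?e]
    by (intro eq_matI) (auto simp: B B_def row col)
  \<comment> \<open>Unitarity of \<open>B\<close> is read off from the lower right block of
    \<open>A * mat_adjoint A = 1\<^sub>m (Suc n)\<close>.\<close>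
  have "direct_sum_scalar (?e * cnj ?e) (B * mat_adjoint B) = A * mat_adjoint A"
    using B B' by (subst (3 4) AB) (simp add: mat_adjoint_direct_sum_scalar direct_sum_scalar_mult)
  also have "\<dots> = direct_sum_scalar 1 (1\<^sub>m n)"
    by (simp add: unitary_matD[OF A] direct_sum_scalar_one)
  finally have "B * mat_adjoint B = 1\<^sub>m n"
    by (rule direct_sum_scalar_eqD) (use B B' in auto)
  thus ?thesis using that B unitary_matI[OF B] AB by blast
qed

lemma unitary_mat_direct_sum_scalar_1:
  assumes "U \<in> carrier_mat n n" "unitary_mat U"
  shows "unitary_mat (direct_sum_scalar 1 U)"
  by (rule unitary_matI[of _ "Suc n"])
     (use assms mat_adjoint_carrier[OF assms(1)] in \<open>simp_all add: mat_adjoint_direct_sum_scalar direct_sum_scalar_mult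
        unitary_matD direct_sum_scalar_one\<close>)

lemma unitary_conj_similar_mat_wit:
  assumes "A \<in> carrier_mat n n" "U \<in> carrier_mat n n" "unitary_mat U"
  shows "similar_mat_wit (U * A * mat_adjoint U) A U (mat_adjoint U)"
  using assms mat_adjoint_carrier[OF assms(2)]
  by (intro similar_mat_witI[of _ _ n]) (auto simp: unitary_matD)

lemma unitary_conj_cancel:
  assumes "A \<in> carrier_mat n n" "U \<in> carrier_mat n n" "unitary_mat U"
    and "B = mat_adjoint U * A * U"
  shows "A = U * B * mat_adjoint U"
proof -
  note U' = mat_adjoint_carrier[OF assms(2)]
  have "U * B * mat_adjoint U = (U * mat_adjoint U) * A * (U * mat_adjoint U)"
    using assms U' by (simp add: assoc_mult_mat[of _ n n _ n _ n])
  thus ?thesis using assms by (simp add: unitary_matD)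
qed

text \<open>Induction on the list of roots. A unitary matrix whose first column is an eigenvector
  for the first root conjugates \<open>A\<close> into a scalar block and a smaller unitary block, to
  which the hypothesis applies. Recursion on the list fixes the order of the eigenvalues, so
  matrices with equal characteristic polynomials get the same diagonal matrix.\<close>

lemma unitary_diagonalization:
  fixes A :: "complex mat"
  assumes "A \<in> carrier_mat n n" "unitary_mat A" "char_poly A = (\<Prod>a\<leftarrow>as. [:- a, 1:])"
  shows "\<exists>U \<in> carrier_mat n n. unitary_mat U \<and> A = U * mat_diag n ((!) as) * mat_adjoint U"
  using assms
proof (induction as arbitrary: n A)
  case Nil
  hence "n = 0"
    using degree_monic_char_poly[OF Nil.prems(1)] by simp
  thus ?case
    using Nil.prems(1) mat_adjoint_carrier[OF Nil.prems(1)]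
    by (intro bexI[of _ A] conjI Nil.prems(2)) (auto intro!: eq_matI simp: mat_diag_def)
next
  case (Cons a as)
  note A = Cons.prems(1,2)
  have ev: "eigenvalue A a"
    by (simp add: eigenvalue_root_char_poly[OF A(1)] Cons.prems(3))
  then obtain v where v: "v \<in> carrier_vec n" "v \<noteq> 0\<^sub>v n" "A *\<^sub>v v = a \<cdot>\<^sub>v v"
    using A(1) unfolding eigenvalue_def eigenvector_def by auto
  then obtain m where m: "n = Suc m"
    by (cases n) auto
  obtain W c where W: "W \<in> carrier_mat n n" "unitary_mat W" and col: "col W 0 = c \<cdot>\<^sub>v v"
    using unitary_mat_with_eigenvector_col[OF v(1,2)] by blast
  note W' = mat_adjoint_carrier[OF W(1)] unitary_mat_adjoint[OF W]
  define B where "B = mat_adjoint W * A * W"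
  have B: "B \<in> carrier_mat n n" "unitary_mat B"
    using A W W' by (auto simp: B_def intro!: unitary_mat_mult[of _ n])
  have AB: "A = W * B * mat_adjoint W"
    by (rule unitary_conj_cancel[OF A(1) W B_def])
  \<comment> \<open>Column 0 of \<open>B\<close> is computed from right to left: \<open>A\<close>
    scales column 0 of \<open>W\<close> by \<open>a\<close>, and the adjoint of \<open>W\<close>
    sends that column to the first unit vector.\<close>
  have "B = mat_adjoint W * (A * W)"
    unfolding B_def by (rule assoc_mult_mat[OF W'(1) A(1) W(1)])
  hence "col B 0 = mat_adjoint W *\<^sub>v (A *\<^sub>v col W 0)"
    using m by (simp only: col_mult2[OF W'(1) mult_carrier_mat[OF A(1) W(1)]] col_mult2[OF A(1) W(1)])
  also have "A *\<^sub>v col W 0 = a \<cdot>\<^sub>v col W 0"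
    using v A unfolding col by (simp add: mult_mat_vec smult_smult_assoc mult.commute)
  also have "mat_adjoint W *\<^sub>v \<dots> = a \<cdot>\<^sub>v (mat_adjoint W *\<^sub>v col W 0)"
    by (rule mult_mat_vec[OF W'(1)]) (use W in auto)
  also have "\<dots> = a \<cdot>\<^sub>v col (mat_adjoint W * W) 0"
    using m by (simp only: col_mult2[OF W'(1) W(1)])
  also have "\<dots> = a \<cdot>\<^sub>v unit_vec n 0"
    using m by (simp add: unitary_matD[OF W])
  finally have col0: "col B 0 = a \<cdot>\<^sub>v unit_vec n 0" .
  have colB: "B $$ (i, 0) = (if i = 0 then a else 0)" if "i < n" for i
    using arg_cong[OF col0, of "\<lambda>x. x $ i"] that B(1) m by simp
  obtain C where C: "C \<in> carrier_mat m m" "unitary_mat C" "B = direct_sum_scalar a C"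
    using unitary_mat_first_col_scalar[of B m] B colB m by auto
  have "similar_mat A B"
    unfolding similar_mat_def using unitary_conj_similar_mat_wit[OF B(1) W] AB by auto
  hence "char_poly A = [:- a, 1:] * char_poly C"
    using char_poly_direct_sum_scalar[OF C(1)] C(3) by (simp add: char_poly_similar)
  hence "[:- a, 1:] * char_poly C = [:- a, 1:] * (\<Prod>a\<leftarrow>as. [:- a, 1:])"
    using Cons.prems(3) by (simp del: mult_pCons_left)
  hence "char_poly C = (\<Prod>a\<leftarrow>as. [:- a, 1:])"
    by (simp only: mult_cancel_left) simp
  from Cons.IH[OF C(1,2) this] obtain V where V: "V \<in> carrier_mat m m" "unitary_mat V"
    "C = V * mat_diag m ((!) as) * mat_adjoint V" by blast
  note V' = mat_adjoint_carrier[OF V(1)]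
  define X where "X = direct_sum_scalar 1 V"
  have X: "X \<in> carrier_mat n n" "unitary_mat X"
    using V by (auto simp: X_def m unitary_mat_direct_sum_scalar_1)
  note X' = mat_adjoint_carrier[OF X(1)]
  define D where "D = mat_diag n ((!) (a # as))"
  have D: "D \<in> carrier_mat n n" by (simp add: D_def)
  \<comment> \<open>The scalar is written as a triple product so that the block sum factors into
    three block sums.\<close>
  have "B = direct_sum_scalar (1 * a * cnj 1) (V * mat_diag m ((!) as) * mat_adjoint V)"
    using C(3) V(3) by simp
  also have "\<dots> = X * D * mat_adjoint X"
    using V V' mat_diag_dim[of m "(!) as"] unfolding X_def D_def m direct_sum_scalar_mat_diag[symmetric]
    by (simp only: direct_sum_scalar_mult[of _ m] mult_carrier_mat[of _ m m _ m] mat_adjoint_direct_sum_scalar[of _ m])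
  finally have "A = (W * X) * D * mat_adjoint (W * X)"
    unfolding AB mat_adjoint_mult[OF W(1) X(1)] using W W' X X' D
    by (simp add: assoc_mult_mat[of _ n n _ n _ n])
  thus ?case
    unfolding D_def using W X by (intro bexI[of _ "W * X"]) (auto intro!: unitary_mat_mult[of _ n])
qed

section \<open>From unitary conjugating matrices to ones of determinant 1\<close>

lemma det_mat_adjoint:
  fixes A :: "complex mat"
  assumes "A \<in> carrier_mat n n"
  shows "det (mat_adjoint A) = cnj (det A)"
proof -
  interpret cnj: comm_ring_hom cnj
    by unfold_locales auto
  have "mat_adjoint A = map_mat cnj (transpose_mat A)"
    using assms mat_adjoint_carrier[OF assms] by (intro eq_matI) (auto simp: mat_adjoint_index)
  thus ?thesis
    using assms by (simp add: cnj.hom_det det_transpose)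
qed

lemma smult_smult_mat: "a \<cdot>\<^sub>m (b \<cdot>\<^sub>m A) = (a * b) \<cdot>\<^sub>m A" for a b :: "'a :: semigroup_mult"
  by (intro eq_matI) (auto simp: mult.assoc)

lemma one_smult_mat: "1 \<cdot>\<^sub>m A = A" for A :: "'a :: monoid_mult mat"
  by (intro eq_matI) auto

lemma mat_adjoint_smult:
  fixes A :: "complex mat"
  assumes "A \<in> carrier_mat n n"
  shows "mat_adjoint (c \<cdot>\<^sub>m A) = cnj c \<cdot>\<^sub>m mat_adjoint A"
  using assms mat_adjoint_carrier[OF assms] mat_adjoint_carrier[of "c \<cdot>\<^sub>m A" n]
  by (intro eq_matI) (auto simp: mat_adjoint_index[of _ n])

text \<open>The determinant of \<open>U\<close> has modulus 1, so an \<open>n\<close>-th root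
  \<open>c\<close> of its inverse has modulus 1 as well; scaling by \<open>c\<close> multiplies the
  determinant by \<open>c ^ n\<close>.\<close>

lemma unitary_mat_rescale_SU:
  assumes U: "U \<in> carrier_mat n n" "unitary_mat U" and n: "n > 0"
  obtains c where "c * cnj c = 1" "c \<cdot>\<^sub>m U \<in> carrier (SU n)"
proof -
  note U' = mat_adjoint_carrier[OF U(1)]
  have "det U * cnj (det U) = 1"
    using det_mult[OF U(1) U'] by (simp add: unitary_matD[OF U] det_mat_adjoint[OF U(1)])
  hence "(norm (det U))\<^sup>2 = 1"
    by (metis complex_norm_square of_real_eq_1_iff)
  hence norm: "norm (det U) = 1"
    using power_eq_1_iff[of "norm (det U)" 2] by simp
  hence det0: "det U \<noteq> 0"
    by auto
  have "card {z. z ^ n = inverse (det U)} = n"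
    using det0 n by (intro card_nth_roots) auto
  then obtain c where c: "c ^ n = inverse (det U)"
    using n by (metis (mono_tags, lifting) card.empty empty_Collect_eq less_numeral_extra(3))
  have "norm c ^ n = 1"
    using arg_cong[OF c, of norm] norm by (simp add: norm_power norm_inverse)
  hence "norm c = 1"
    using n power_eq_1_iff[of "norm c" n] by simp
  hence cc: "c * cnj c = 1"
    by (simp flip: complex_norm_square)
  have "unitary_mat (c \<cdot>\<^sub>m U)"
    using U U' cc by (intro unitary_matI[of _ n])
      (auto simp: mat_adjoint_smult[OF U(1)] mult_smult_distrib[of _ n n _ n] mult_smult_assoc_mat[of _ n n _ n]
        unitary_matD[OF U] smult_smult_mat mult.commute)
  moreover have "det (c \<cdot>\<^sub>m U) = 1"
    using U c det0 by simp
  ultimately show ?thesis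
    using that[OF cc] U by (simp add: carrier_SU)
qed

text \<open>Rescaling the conjugating matrix by \<open>c\<close> changes nothing, because
  conjugation brings in the factor \<open>c * cnj c = 1\<close>.\<close>

lemma SU_diagonalization:
  assumes A: "A \<in> carrier (SU n)" and n: "n > 0" and cp: "char_poly A = (\<Prod>a\<leftarrow>as. [:- a, 1:])"
  obtains U where "U \<in> carrier (SU n)" "A = U * mat_diag n ((!) as) * mat_adjoint U"
proof -
  define D where "D = mat_diag n ((!) as)"
  have D: "D \<in> carrier_mat n n" by (simp add: D_def)
  obtain U where U: "U \<in> carrier_mat n n" "unitary_mat U" "A = U * D * mat_adjoint U"
    using unitary_diagonalization[OF _ _ cp, of n] A by (auto simp: carrier_SU D_def)
  note U' = mat_adjoint_carrier[OF U(1)]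
  obtain c where c: "c * cnj c = 1" "c \<cdot>\<^sub>m U \<in> carrier (SU n)"
    using unitary_mat_rescale_SU[OF U(1,2) n] .
  have "(c \<cdot>\<^sub>m U) * D * mat_adjoint (c \<cdot>\<^sub>m U) = (cnj c * c) \<cdot>\<^sub>m (U * D * mat_adjoint U)"
    using U U' D by (simp add: mat_adjoint_smult[OF U(1)] mult_smult_distrib[of _ n n _ n]
        mult_smult_assoc_mat[of _ n n _ n] smult_smult_mat)
  also have "\<dots> = A"
    using c(1) U(3) by (simp add: mult.commute one_smult_mat)
  finally show ?thesis
    using that[OF c(2)] by (simp add: D_def)
qed

section \<open>Conjugacy classes of the special unitary group\<close>

lemma inv_SU: "A \<in> carrier (SU n) \<Longrightarrow> inv\<^bsub>SU n\<^esub> A = mat_adjoint A"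
  using group.inv_equality[OF group_SU] adjoint_in_SU by (metis mult_SU one_SU)

lemma pow_SU: "A \<in> carrier (SU n) \<Longrightarrow> A [^]\<^bsub>SU n\<^esub> (k :: nat) = A ^\<^sub>m k"
  by (induction k) (auto simp: one_SU mult_SU carrier_SU)

text \<open>Similar matrices share their characteristic polynomial. Conversely, a common list of
  roots diagonalizes both matrices to the same \<open>D\<close>, and conjugators can be composed
  through \<open>D\<close>.\<close>

lemma orbit_SU_conjugation:
  assumes n: "n > 0" and A: "A \<in> carrier (SU n)"
  shows "orbit (SU n) (\<lambda>g. \<lambda>h\<in>carrier (SU n). g \<otimes>\<^bsub>SU n\<^esub> h \<otimes>\<^bsub>SU n\<^esub> inv\<^bsub>SU n\<^esub> g) A
           = {B \<in> carrier (SU n). char_poly B = char_poly A}" (is "?O = ?S")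
proof -
  interpret group "SU n" by (rule group_SU)
  have O: "?O = {g * A * mat_adjoint g |g. g \<in> carrier (SU n)}"
    unfolding orbit_def using A by (intro Collect_cong ex_cong1) (auto simp: mult_SU inv_SU)
  show ?thesis
  proof (intro subset_antisym subsetI)
    fix B assume "B \<in> ?O"
    then obtain g where g: "g \<in> carrier (SU n)" "B = g * A * mat_adjoint g"
      using O by blast
    have "B \<in> carrier (SU n)"
      unfolding g(2) mult_SU[of n, symmetric] using g(1) A adjoint_in_SU(1) by (intro m_closed)
    moreover have "similar_mat B A"
      using unitary_conj_similar_mat_wit[of A n g] g A unfolding similar_mat_def carrier_SU by blast
    ultimately show "B \<in> ?S"
      by (simp add: char_poly_similar)
  next
    fix B assume "B \<in> ?S"
    hence B: "B \<in> carrier (SU n)" "char_poly B = char_poly A" by auto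
    obtain as where as: "char_poly A = (\<Prod>a\<leftarrow>as. [:- a, 1:])"
      using char_poly_factorized A by (auto simp: carrier_SU)
    define D where "D = mat_diag n ((!) as)"
    have D: "D \<in> carrier_mat n n" by (simp add: D_def)
    obtain U where U: "U \<in> carrier (SU n)" "A = U * D * mat_adjoint U"
      using SU_diagonalization[OF A n as] unfolding D_def .
    obtain V where V: "V \<in> carrier (SU n)" "B = V * D * mat_adjoint V"
      using SU_diagonalization[OF B(1) n] B(2) as unfolding D_def by metis
    have Um: "U \<in> carrier_mat n n" "mat_adjoint U \<in> carrier_mat n n"
      and Vm: "V \<in> carrier_mat n n" "mat_adjoint V \<in> carrier_mat n n"
      using U V mat_adjoint_carrier by (auto simp: carrier_SU)
    \<comment> \<open>The adjoint of \<open>U\<close> carries \<open>A\<close> to \<open>D\<close>,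
      and \<open>V\<close> carries \<open>D\<close> to \<open>B\<close>.\<close>
    define g where "g = V * mat_adjoint U"
    have "g \<in> carrier (SU n)"
      unfolding g_def mult_SU[of n, symmetric] using U V adjoint_in_SU(1) by (intro m_closed)
    moreover have "g * A * mat_adjoint g = B"
    proof -
      have "mat_adjoint g = U * mat_adjoint V"
        unfolding g_def using Um Vm by (simp add: mat_adjoint_mult mat_adjoint_adjoint)
      hence "g * A * mat_adjoint g = V * ((mat_adjoint U * U) * D * (mat_adjoint U * U)) * mat_adjoint V"
        unfolding g_def U(2) using Um Vm D by (simp add: assoc_mult_mat[of _ n n _ n _ n])
      thus ?thesis
        using D V adjoint_in_SU(2)[OF U(1)] by simp
    qed
    ultimately show "B \<in> ?O"
      using O by blast
  qed
qed

lemma conjugacy_classes_SU: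
  assumes "n > 0"
  shows "conjugacy_classes (SU n) =
           (\<lambda>A. {B \<in> carrier (SU n). char_poly B = char_poly A}) ` carrier (SU n)"
  unfolding conjugacy_classes_def orbits_def using orbit_SU_conjugation[OF assms] by auto

section \<open>Diagonal representatives and lists of eigenvalues\<close>

lemma mat_diag_pow: "mat_diag n f ^\<^sub>m k = mat_diag n (\<lambda>i. f i ^ k :: 'a :: comm_semiring_1)"
proof (induction k)
  case 0
  show ?case by (simp add: mat_diag_def[of n f] carrier_matD)
qed (simp add: mult.commute)

lemma diag_mat_mat_diag: "diag_mat (mat_diag (length as) ((!) as)) = as"
  by (intro nth_equalityI) (auto simp: diag_mat_def mat_diag_def)

lemma upper_triangular_mat_diag: "upper_triangular (mat_diag n f)"
  by (auto simp: mat_diag_def)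

lemma det_mat_diag: "det (mat_diag (length as) ((!) as)) = prod_list as"
  using det_upper_triangular[OF upper_triangular_mat_diag mat_diag_dim, of "length as" "(!) as"]
  by (simp add: diag_mat_mat_diag)

lemma char_poly_mat_diag:
  "char_poly (mat_diag (length as) ((!) as)) = (\<Prod>a\<leftarrow>as. [:- a, 1:])"
  using char_poly_upper_triangular[OF mat_diag_dim upper_triangular_mat_diag, of "length as" "(!) as"]
  by (simp add: diag_mat_mat_diag)

lemma mat_diag_nth_eq_one_iff: "mat_diag n f = 1\<^sub>m n \<longleftrightarrow> (\<forall>i<n. f i = 1)"
proof
  assume *: "mat_diag n f = 1\<^sub>m n"
  show "\<forall>i<n. f i = 1"
  proof (intro allI impI)
    fix i assume "i < n"
    thus "f i = 1" using arg_cong[OF *, of "\<lambda>M. M $$ (i, i)"] by (simp add: mat_diag_def)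
  qed
qed (auto simp: mat_diag_def)

lemma mat_diag_in_SU:
  assumes "prod_list as = 1" "\<forall>a\<in>set as. norm a = 1"
  shows "mat_diag (length as) ((!) as) \<in> carrier (SU (length as))"
proof -
  let ?n = "length as"
  let ?D = "mat_diag ?n ((!) as)"
  have "mat_adjoint ?D = mat_diag ?n (\<lambda>i. cnj (as ! i))" (is "?L = ?R")
  proof (rule eq_matI)
    fix i j assume "i < dim_row ?R" "j < dim_col ?R"
    hence "i < ?n" "j < ?n" by (simp_all add: mat_diag_def)
    thus "?L $$ (i, j) = ?R $$ (i, j)"
      unfolding mat_adjoint_index[OF mat_diag_dim \<open>i < ?n\<close> \<open>j < ?n\<close>] by (simp add: mat_diag_def)
  qed (use mat_adjoint_carrier[OF mat_diag_dim, of ?n "(!) as"] in \<open>simp_all add: mat_diag_def\<close>)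
  hence "?D * mat_adjoint ?D = 1\<^sub>m ?n"
    using assms(2) by (auto simp: mat_diag_nth_eq_one_iff simp flip: complex_norm_square)
  hence "unitary_mat ?D"
    by (rule unitary_matI[OF mat_diag_dim])
  thus ?thesis
    using assms(1) by (simp add: carrier_SU det_mat_diag)
qed

text \<open>Turns the conditions on a matrix that are being counted into conditions on its list of
  eigenvalues. The power condition can be tested on the eigenvalues because \<open>A\<close> is
  diagonalizable.\<close>

lemma SU_eigenvalues:
  assumes A: "A \<in> carrier (SU n)" and n: "n > 0" and cp: "char_poly A = (\<Prod>a\<leftarrow>as. [:- a, 1:])"
  shows "length as = n" "prod_list as = 1" "spectrum A = set as"
    and "A [^]\<^bsub>SU n\<^esub> q = \<one>\<^bsub>SU n\<^esub> \<longleftrightarrow> (\<forall>a\<in>set as. a ^ q = 1)"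
proof -
  have Am: "A \<in> carrier_mat n n" "det A = 1"
    using A by (auto simp: carrier_SU)
  obtain U where U: "U \<in> carrier (SU n)" "A = U * mat_diag n ((!) as) * mat_adjoint U"
    using SU_diagonalization[OF A n cp] .
  have Um: "U \<in> carrier_mat n n" "unitary_mat U"
    using U by (auto simp: carrier_SU)
  have sim: "similar_mat_wit A (mat_diag n ((!) as)) U (mat_adjoint U)"
    using unitary_conj_similar_mat_wit[OF mat_diag_dim Um] U(2) by simp
  show len: "length as = n"
    using degree_monic_char_poly[OF Am(1)] degree_linear_factors[of uminus as] cp by simp
  have "similar_mat A (mat_diag n ((!) as))"
    using sim by (auto simp: similar_mat_def)
  hence "det A = det (mat_diag n ((!) as))"
    by (rule det_similar)
  thus "prod_list as = 1"
    using Am(2) len by (auto simp: det_mat_diag)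
  show "spectrum A = set as"
    by (auto simp: spectrum_root_char_poly[OF Am(1)] cp poly_prod_list prod_list_zero_iff)
  \<comment> \<open>The \<open>q\<close>-th powers are conjugate through the same \<open>U\<close>,
    so one of them is the identity exactly when the other is.\<close>
  have simq: "similar_mat_wit (A ^\<^sub>m q) (mat_diag n (\<lambda>i. (as ! i) ^ q)) U (mat_adjoint U)"
    using similar_mat_wit_pow[OF sim, of q] by (simp add: mat_diag_pow)
  have "A ^\<^sub>m q = 1\<^sub>m n \<longleftrightarrow> mat_diag n (\<lambda>i. (as ! i) ^ q) = 1\<^sub>m n"
  proof
    assume *: "A ^\<^sub>m q = 1\<^sub>m n"
    show "mat_diag n (\<lambda>i. (as ! i) ^ q) = 1\<^sub>m n"
      using similar_mat_witD2(3)[OF mat_diag_dim similar_mat_wit_sym[OF simq]]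
        mat_adjoint_carrier[OF Um(1)] by (simp add: * unitary_matD[OF Um])
  next
    assume *: "mat_diag n (\<lambda>i. (as ! i) ^ q) = 1\<^sub>m n"
    show "A ^\<^sub>m q = 1\<^sub>m n"
      using similar_mat_witD2(3)[OF pow_carrier_mat[OF Am(1)] simq] Um
      by (simp add: * unitary_matD[OF Um])
  qed
  thus "A [^]\<^bsub>SU n\<^esub> q = \<one>\<^bsub>SU n\<^esub> \<longleftrightarrow> (\<forall>a\<in>set as. a ^ q = 1)"
    by (simp add: pow_SU[OF A] one_SU mat_diag_nth_eq_one_iff all_set_conv_all_nth len)
qed

text \<open>Recovers the multiset from its monic polynomial; this yields injectivity of the map from
  multisets to classes. Nonvanishing of the products is needed for
  \<open>proots_mult\<close>.\<close>

lemma proots_prod_linear_factors: "proots (\<Prod>a\<in>#M. [:- a, 1:]) = (M :: 'a :: idom multiset)"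
proof -
  have "(\<Prod>a\<in>#N. [:- a, 1:]) \<noteq> (0 :: 'a poly)" for N
    by (induction N) (simp_all del: mult_pCons_left)
  thus ?thesis
    by (induction M) (simp_all add: proots_mult del: mult_pCons_left)
qed

lemma num_conj_classes_SU:
  assumes "n > 0" "q > 0"
  shows "num_conj_classes (SU n) q s =
           card {M :: complex multiset. (\<forall>z\<in>#M. z ^ q = 1) \<and> size M = n \<and>
                   card (set_mset M) = s \<and> prod_mset M = 1}" (is "_ = card ?Ms")
proof -
  \<comment> \<open>\<open>cls\<close> will be the bijection from multisets to classes. For an
    arbitrary \<open>M\<close> its value may be empty; \<open>ex\<close> below excludes this for the
    multisets that are counted.\<close>
  define cls :: "complex multiset \<Rightarrow> complex mat set" where
    "cls M = {B \<in> carrier (SU n). char_poly B = (\<Prod>a\<in>#M. [:- a, 1:])}" for M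
  let ?Q = "\<lambda>x. x [^]\<^bsub>SU n\<^esub> q = \<one>\<^bsub>SU n\<^esub> \<and> card (spectrum x) = s"
  let ?Cs = "{C \<in> conjugacy_classes (SU n). \<forall>x\<in>C. ?Q x}"
  have cls_eq: "cls (mset as) = {B \<in> carrier (SU n). char_poly B = char_poly A}"
    if "char_poly A = (\<Prod>a\<leftarrow>as. [:- a, 1:])" for A as
    using that by (simp add: cls_def mset_map prod_mset_prod_list flip: mset_map)
  have ex: "\<exists>A \<in> carrier (SU n). char_poly A = (\<Prod>a\<leftarrow>as. [:- a, 1:])" if "mset as \<in> ?Ms" for as
  proof -
    have "norm a = 1" if "a \<in> set as" for a
    proof -
      have "a ^ q = 1" using that \<open>mset as \<in> ?Ms\<close> by simp
      \<comment> \<open>Roots of unity have modulus 1, which makes the diagonal matrix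
        unitary.\<close>
      thus ?thesis using power_eq_1_iff[of a q] assms(2) by simp
    qed
    hence "mat_diag (length as) ((!) as) \<in> carrier (SU (length as))"
      using that by (intro mat_diag_in_SU) (auto simp: prod_mset_prod_list)
    moreover have "length as = n" using that by simp
    ultimately show ?thesis using char_poly_mat_diag[of as] by auto
  qed
  have "bij_betw cls ?Ms ?Cs"
  proof (rule bij_betw_imageI)
    show "inj_on cls ?Ms"
    proof (rule inj_onI)
      fix M N assume "M \<in> ?Ms" "cls M = cls N"
      moreover obtain as where "M = mset as" by (metis ex_mset)
      \<comment> \<open>A nonempty common class supplies one matrix whose characteristic polynomial
        equals both products.\<close>
      ultimately obtain A where "A \<in> cls M" "A \<in> cls N"
        using ex[of as] cls_eq by blast
      hence "(\<Prod>a\<in>#M. [:- a, 1:]) = (\<Prod>a\<in>#N. [:- a, 1:])"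
        by (simp add: cls_def)
      thus "M = N" by (metis proots_prod_linear_factors)
    qed
    show "cls ` ?Ms = ?Cs"
    proof (intro subset_antisym subsetI)
      fix C assume "C \<in> cls ` ?Ms"
      then obtain as where as: "mset as \<in> ?Ms" "C = cls (mset as)" by (metis (no_types, lifting) ex_mset imageE)
      obtain A where A: "A \<in> carrier (SU n)" "char_poly A = (\<Prod>a\<leftarrow>as. [:- a, 1:])"
        using ex[OF as(1)] by blast
      have C: "C = {B \<in> carrier (SU n). char_poly B = char_poly A}"
        unfolding as(2) by (rule cls_eq[OF A(2)])
      hence "C \<in> conjugacy_classes (SU n)"
        using A(1) by (auto simp: conjugacy_classes_SU[OF assms(1)])
      moreover have "?Q B" if "B \<in> C" for B
        using SU_eigenvalues(3)[of B n as] SU_eigenvalues(4)[of B n as q] that as(1) A(2) assms(1) C by simp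
      ultimately show "C \<in> ?Cs" by blast
    next
      fix C assume C: "C \<in> ?Cs"
      then obtain A where A: "A \<in> carrier (SU n)" "C = {B \<in> carrier (SU n). char_poly B = char_poly A}"
        by (auto simp: conjugacy_classes_SU[OF assms(1)])
      \<comment> \<open>The class contains its representative \<open>A\<close>, so the condition on
        all members is not vacuous.\<close>
      hence Q: "?Q A" using C by blast
      obtain as where as: "char_poly A = (\<Prod>a\<leftarrow>as. [:- a, 1:])"
        using char_poly_factorized A(1) by (auto simp: carrier_SU)
      note ev = SU_eigenvalues[OF A(1) assms(1) as]
      have "mset as \<in> ?Ms"
        using ev(1-3) ev(4) Q by (simp add: prod_mset_prod_list)
      moreover have "C = cls (mset as)"
        using cls_eq[OF as] A(2) by simp
      ultimately show "C \<in> cls ` ?Ms" by blast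
    qed
  qed
  thus ?thesis
    unfolding num_conj_classes_def by (simp flip: bij_betw_same_card)
qed

theorem theorem4:
  fixes p q s :: nat
  assumes "p > 0" and "q > 0" and "gcd p q = 1" and "s > 0"
  shows "real (num_conj_classes (SU p) q s) = 1 / real q * real ((p - 1) choose (s - 1)) * real (q choose s)
       \<and> 1 / real q * real ((p - 1) choose (s - 1)) * real (q choose s)
           = real s / (real p * real q) * real (p choose s) * real (q choose s)"
proof
  have "coprime p q"
    using assms(3) by (simp add: coprime_iff_gcd_eq_1)
  hence "q * num_conj_classes (SU p) q s = ((p - 1) choose (s - 1)) * (q choose s)"
    using card_multisets_roots_of_unity_prod_1 num_conj_classes_SU assms by simp
  hence "real q * real (num_conj_classes (SU p) q s)
           = real ((p - 1) choose (s - 1)) * real (q choose s)"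
    by (metis of_nat_mult)
  thus "real (num_conj_classes (SU p) q s)
      = 1 / real q * real ((p - 1) choose (s - 1)) * real (q choose s)"
    using assms(2) by (simp add: field_simps)
  \<comment> \<open>The absorption identity for binomials links the two closed forms.\<close>
  have "s * (p choose s) = p * ((p - 1) choose (s - 1))"
    using assms(4) by (simp add: times_binomial_minus1_eq)
  hence "real s * real (p choose s) = real p * real ((p - 1) choose (s - 1))"
    by (metis of_nat_mult)
  thus "1 / real q * real ((p - 1) choose (s - 1)) * real (q choose s)
      = real s / (real p * real q) * real (p choose s) * real (q choose s)"
    using assms(1,2) by (simp add: field_simps)
qed

end
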